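(* Let $\lambda,\mu\vdash n$ and suppose that $s_\lambda * s_\mu$ has a saturated Newton polytope. Then for every collection of partitions $\alpha^1,\alpha^2,\ldots$ such that $g(\lambda,\mu,\alpha^i)>0$ for all $i$ and such that $\sum_i t_i\alpha^i$ has integer parts for some $t_i\in[0,1]$ with $t_1+t_2+\cdots=1$, there exists a partition $\theta\succeq \mathrm{sort}\big(\sum_i t_i\alpha^i\big)$ in the dominance order such that $g(\lambda,\mu,\theta)>0$.
   Context: For partitions $\lambda,\mu,\nu\vdash n$, the Kronecker coefficient $g(\lambda,\mu,\nu)$ is the multiplicity of the Specht module $\mathbb{S}_\nu$ in the $S_n$-module $\mathbb{S}_\lambda\otimes\mathbb{S}_\mu$ (over $\mathbb{C}$), and $s_\lambda * s_\mu := \sum_{\nu\vdash n} g(\lambda,\mu,\nu)s_\nu$. Partitions are regarded as vectors padded with zeros; $\mathrm{sort}(\gamma)$ is the vector obtained by listing the entries of $\gamma$ in weakly decreasing order. Dominance order: $\theta\succeq\gamma$ iff $\theta_1+\cdots+\theta_i\geq\gamma_1+\cdots+\gamma_i$ for all $i$ (for partitions of the same size). A polynomial $f(x_1,\ldots,x_k)=\sum_\alpha c_\alpha x^\alpha$ with nonnegative coefficients has a saturated Newton polytope if $M_k(f)=\{\alpha\in\mathbb{Z}_{\ge0}^k: c_\alpha>0\}$ equals $\mathrm{conv}(M_k(f))\cap\mathbb{Z}^k$; a symmetric function $f$ has a saturated Newton polytope if its specialization $f(x_1,\ldots,x_k)$ (setting $x_m=0$ for $m\geq k+1$) does for every $k\geq1$.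 *)

theory Defs
  imports
    "HOL-Analysis.Analysis"
    "HOL-Analysis.Finite_Function_Topology"
    "HOL-Combinatorics.Permutations"
    "HOL-Library.Function_Algebras"
begin

section \<open>Partitions\<close>

text \<open>
  Vectors padded with zeros are finitely supported functions on \<open>nat\<close>. Everything is indexed
  from 0: the \<open>i\<close>-th part of \<open>lam\<close> (counting from 1) is \<open>lookup lam (i - 1)\<close>.
\<close>

abbreviation lookup :: "('a \<Rightarrow>\<^sub>0 'b::zero) \<Rightarrow> 'a \<Rightarrow> 'b"
  where "lookup \<equiv> Poly_Mapping.lookup"

abbreviation keys :: "('a \<Rightarrow>\<^sub>0 'b::zero) \<Rightarrow> 'a set"
  where "keys \<equiv> Poly_Mapping.keys"

abbreviation real_vec :: "(nat \<Rightarrow>\<^sub>0 nat) \<Rightarrow> (nat \<Rightarrow>\<^sub>0 real)"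
  where "real_vec \<equiv> Poly_Mapping.map real"

definition partition_of :: "(nat \<Rightarrow>\<^sub>0 nat) \<Rightarrow> nat \<Rightarrow> bool"  (infix \<open>\<turnstile>\<close> 50)
  where "lam \<turnstile> n \<longleftrightarrow> antimono (lookup lam) \<and> (\<Sum>i\<in>keys lam. lookup lam i) = n"

text \<open>Only for vectors with nonnegative entries: the zero entries are moved to the end.\<close>

definition sort_desc :: "(nat \<Rightarrow>\<^sub>0 'a::{zero,linorder}) \<Rightarrow> (nat \<Rightarrow>\<^sub>0 'a)"
  where "sort_desc \<gamma> =
    Poly_Mapping.nth (rev (sort (map (lookup \<gamma>) (sorted_list_of_set (keys \<gamma>)))))"

definition dominates :: "(nat \<Rightarrow>\<^sub>0 'a::{comm_monoid_add,ord}) \<Rightarrow> (nat \<Rightarrow>\<^sub>0 'a) \<Rightarrow> bool"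
  where "dominates \<theta> \<gamma> \<longleftrightarrow> (\<forall>i. (\<Sum>j<i. lookup \<gamma> j) \<le> (\<Sum>j<i. lookup \<theta> j))"

definition cells :: "(nat \<Rightarrow>\<^sub>0 nat) \<Rightarrow> (nat \<times> nat) set"
  where "cells lam = {(i, j). j < lookup lam i}"


section \<open>Complex representations of the symmetric group\<close>

definition cscale :: "complex \<Rightarrow> ('x \<Rightarrow> complex) \<Rightarrow> ('x \<Rightarrow> complex)"
  where "cscale c f = (\<lambda>x. c * f x)"

global_interpretation cfun: vector_space "cscale :: complex \<Rightarrow> ('x \<Rightarrow> complex) \<Rightarrow> _"
  by unfold_locales (auto simp: cscale_def fun_eq_iff algebra_simps)

text \<open>
  The group \<open>S\<^sub>n\<close> is \<open>{\<sigma>. \<sigma> permutes {..<n}}\<close>. All modules occurring here are subspaces of a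
  space of functions \<open>'x \<Rightarrow> complex\<close>, on which \<open>S\<^sub>n\<close> acts through an action \<open>a\<close> on the points by
  \<open>(\<sigma> f)(x) = f(\<sigma>\<^sup>-\<^sup>1 x)\<close>. Thus \<open>\<sigma>\<close> sends the indicator function of \<open>x\<close> to that of \<open>a \<sigma> x\<close>.
\<close>

type_synonym 'x point_action = "(nat \<Rightarrow> nat) \<Rightarrow> 'x \<Rightarrow> 'x"

definition translate :: "'x point_action \<Rightarrow> (nat \<Rightarrow> nat) \<Rightarrow> ('x \<Rightarrow> complex) \<Rightarrow> ('x \<Rightarrow> complex)"
  where "translate a \<sigma> f = (\<lambda>x. f (a (inv \<sigma>) x))"

definition submodule :: "nat \<Rightarrow> 'x point_action \<Rightarrow> ('x \<Rightarrow> complex) set \<Rightarrow> bool"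
  where "submodule n a W \<longleftrightarrow>
    cfun.subspace W \<and> (\<forall>\<sigma>. \<sigma> permutes {..<n} \<longrightarrow> (\<forall>f\<in>W. translate a \<sigma> f \<in> W))"

definition irreducible_module :: "nat \<Rightarrow> 'x point_action \<Rightarrow> ('x \<Rightarrow> complex) set \<Rightarrow> bool"
  where "irreducible_module n a W \<longleftrightarrow>
    submodule n a W \<and> W \<noteq> {0} \<and> (\<forall>U. submodule n a U \<and> U \<subseteq> W \<longrightarrow> U = {0} \<or> U = W)"

definition module_iso ::
    "nat \<Rightarrow> 'x point_action \<Rightarrow> ('x \<Rightarrow> complex) set \<Rightarrow> 'y point_action \<Rightarrow> ('y \<Rightarrow> complex) set \<Rightarrow> bool"
  where "module_iso n a V b W \<longleftrightarrow>
    (\<exists>\<phi>. bij_betw \<phi> V W \<and>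
      (\<forall>f\<in>V. \<forall>g\<in>V. \<phi> (f + g) = \<phi> f + \<phi> g) \<and>
      (\<forall>c. \<forall>f\<in>V. \<phi> (cscale c f) = cscale c (\<phi> f)) \<and>
      (\<forall>\<sigma>. \<sigma> permutes {..<n} \<longrightarrow> (\<forall>f\<in>V. \<phi> (translate a \<sigma> f) = translate b \<sigma> (\<phi> f))))"

text \<open>
  The bijection says that every element of \<open>V\<close> is in exactly one way a sum of elements of
  the summands.
\<close>

definition irreducible_decomposition ::
    "nat \<Rightarrow> 'x point_action \<Rightarrow> ('x \<Rightarrow> complex) set \<Rightarrow> ('x \<Rightarrow> complex) set set \<Rightarrow> bool"
  where "irreducible_decomposition n a V \<W> \<longleftrightarrow>
    finite \<W> \<and> (\<forall>W\<in>\<W>. irreducible_module n a W) \<and>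
    bij_betw (\<lambda>w. \<Sum>W\<in>\<W>. w W) (\<Pi>\<^sub>E W\<in>\<W>. W) V"

text \<open>
  A finite-dimensional \<open>V\<close> has such a decomposition (Maschke), and the number of summands
  isomorphic to a given irreducible \<open>U\<close> is the same in each of them (Krull--Schmidt).
\<close>

definition multiplicity ::
    "nat \<Rightarrow> 'y point_action \<Rightarrow> ('y \<Rightarrow> complex) set \<Rightarrow> 'x point_action \<Rightarrow> ('x \<Rightarrow> complex) set \<Rightarrow> nat"
  where "multiplicity n b U a V =
    (THE m. \<exists>\<W>. irreducible_decomposition n a V \<W> \<and> m = card {W\<in>\<W>. module_iso n a W b U})"


section \<open>Specht modules and Kronecker coefficients\<close>

text \<open>
  A tableau of shape \<open>lam \<turnstile> n\<close> is a bijection from the cells of \<open>lam\<close> to \<open>{..<n}\<close>. Its tabloid is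
  the sequence of the sets of entries of its rows.
\<close>

type_synonym tabloid = "nat \<Rightarrow> nat set"

definition tableaux :: "nat \<Rightarrow> (nat \<Rightarrow>\<^sub>0 nat) \<Rightarrow> (nat \<times> nat \<Rightarrow> nat) set"
  where "tableaux n lam = {t. bij_betw t (cells lam) {..<n}}"

definition tabloid_of :: "(nat \<Rightarrow>\<^sub>0 nat) \<Rightarrow> (nat \<times> nat \<Rightarrow> nat) \<Rightarrow> tabloid"
  where "tabloid_of lam t = (\<lambda>i. t ` {c \<in> cells lam. fst c = i})"

definition tabloid_action :: "tabloid point_action"
  where "tabloid_action \<sigma> T = (\<lambda>i. \<sigma> ` T i)"

definition column_stabilizer ::
    "nat \<Rightarrow> (nat \<Rightarrow>\<^sub>0 nat) \<Rightarrow> (nat \<times> nat \<Rightarrow> nat) \<Rightarrow> (nat \<Rightarrow> nat) set"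
  where "column_stabilizer n lam t =
    {\<pi>. \<pi> permutes {..<n} \<and>
        (\<forall>j. \<pi> ` t ` {c \<in> cells lam. snd c = j} = t ` {c \<in> cells lam. snd c = j})}"

definition polytabloid ::
    "nat \<Rightarrow> (nat \<Rightarrow>\<^sub>0 nat) \<Rightarrow> (nat \<times> nat \<Rightarrow> nat) \<Rightarrow> (tabloid \<Rightarrow> complex)"
  where "polytabloid n lam t = (\<lambda>T. \<Sum>\<pi>\<in>column_stabilizer n lam t.
    of_int (sign \<pi>) * (if T = tabloid_action \<pi> (tabloid_of lam t) then 1 else 0))"

definition specht :: "nat \<Rightarrow> (nat \<Rightarrow>\<^sub>0 nat) \<Rightarrow> (tabloid \<Rightarrow> complex) set"
  where "specht n lam = cfun.span (polytabloid n lam ` tableaux n lam)"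

text \<open>
  The tensor product of two subspaces of function spaces, with \<open>v \<otimes> w\<close> realized as the function
  \<open>(x, y) \<mapsto> v(x) w(y)\<close>, and the diagonal action on it.
\<close>

definition tensor ::
    "('x \<Rightarrow> complex) set \<Rightarrow> ('y \<Rightarrow> complex) set \<Rightarrow> ('x \<times> 'y \<Rightarrow> complex) set"
  where "tensor V W = cfun.span {(\<lambda>(x, y). v x * w y) | v w. v \<in> V \<and> w \<in> W}"

definition diagonal_action :: "'x point_action \<Rightarrow> 'y point_action \<Rightarrow> ('x \<times> 'y) point_action"
  where "diagonal_action a b \<sigma> = map_prod (a \<sigma>) (b \<sigma>)"

definition kronecker :: "nat \<Rightarrow> (nat \<Rightarrow>\<^sub>0 nat) \<Rightarrow> (nat \<Rightarrow>\<^sub>0 nat) \<Rightarrow> (nat \<Rightarrow>\<^sub>0 nat) \<Rightarrow> nat"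
  where "kronecker n lam mu nu =
    multiplicity n tabloid_action (specht n nu)
      (diagonal_action tabloid_action tabloid_action) (tensor (specht n lam) (specht n mu))"


section \<open>Symmetric functions\<close>

text \<open>
  A formal series in the variables \<open>x\<^sub>0, x\<^sub>1, \<dots>\<close> is given by its coefficients: \<open>f \<alpha>\<close> is the
  coefficient of \<open>x\<^sup>\<alpha>\<close>.
\<close>

type_synonym series = "(nat \<Rightarrow>\<^sub>0 nat) \<Rightarrow> int"

text \<open>Tableaux are extensional outside the cells, so that they can be counted.\<close>

definition semistandard_tableaux :: "(nat \<Rightarrow>\<^sub>0 nat) \<Rightarrow> (nat \<times> nat \<Rightarrow> nat) set"
  where "semistandard_tableaux lam = {T \<in> extensional (cells lam).
    (\<forall>i j. (i, Suc j) \<in> cells lam \<longrightarrow> T (i, j) \<le> T (i, Suc j)) \<and>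
    (\<forall>i j. (Suc i, j) \<in> cells lam \<longrightarrow> T (i, j) < T (Suc i, j))}"

text \<open>
  The Schur function is \<open>\<Sum>\<^sub>T x\<^sup>T\<close>, with \<open>T\<close> ranging over the semistandard tableaux; the
  exponent of \<open>x\<^sub>v\<close> in \<open>x\<^sup>T\<close> is the number of entries \<open>v\<close> of \<open>T\<close>.
\<close>

definition schur :: "(nat \<Rightarrow>\<^sub>0 nat) \<Rightarrow> series"
  where "schur lam \<alpha> = int (card {T \<in> semistandard_tableaux lam.
    \<forall>v. card {c \<in> cells lam. T c = v} = lookup \<alpha> v})"

definition kronecker_product :: "nat \<Rightarrow> (nat \<Rightarrow>\<^sub>0 nat) \<Rightarrow> (nat \<Rightarrow>\<^sub>0 nat) \<Rightarrow> series"
  where "kronecker_product n lam mu =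
    (\<lambda>\<alpha>. \<Sum>nu | nu \<turnstile> n. int (kronecker n lam mu nu) * schur nu \<alpha>)"

text \<open>The specialization of \<open>x\<^sub>m\<close> to 0 for \<open>m \<ge> k\<close>, leaving \<open>x\<^sub>0, \<dots>, x\<^sub>k\<^sub>-\<^sub>1\<close>.\<close>

definition specialize :: "nat \<Rightarrow> series \<Rightarrow> series"
  where "specialize k f = (\<lambda>\<alpha>. if keys \<alpha> \<subseteq> {..<k} then f \<alpha> else 0)"

text \<open>In both of the following, \<open>\<real>\<^sup>k\<close> is embedded as the vectors with support in \<open>{..<k}\<close>.\<close>

definition exponents :: "nat \<Rightarrow> series \<Rightarrow> (nat \<Rightarrow>\<^sub>0 real) set"
  where "exponents k f = real_vec ` {\<alpha>. keys \<alpha> \<subseteq> {..<k} \<and> f \<alpha> > 0}"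

definition integer_points :: "nat \<Rightarrow> (nat \<Rightarrow>\<^sub>0 real) set"
  where "integer_points k = {\<beta>. keys \<beta> \<subseteq> {..<k} \<and> (\<forall>i. lookup \<beta> i \<in> \<int>)}"

text \<open>The next two notions are meant for nonnegative coefficients.\<close>

definition saturated_newton_polytope_poly :: "nat \<Rightarrow> series \<Rightarrow> bool"
  where "saturated_newton_polytope_poly k f \<longleftrightarrow>
    exponents k f = convex hull (exponents k f) \<inter> integer_points k"

definition saturated_newton_polytope :: "series \<Rightarrow> bool"
  where "saturated_newton_polytope f \<longleftrightarrow>
    (\<forall>k\<ge>1. saturated_newton_polytope_poly k (specialize k f))"

end

theory Submission
  imports Defs
begin

text \<open>
  The Kronecker coefficients enter only as nonnegative weights. If \<open>g(\<lambda>,\<mu>,\<nu>) > 0\<close>, then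
  \<open>x\<^sup>\<nu>\<close> occurs in \<open>s\<^sub>\<lambda> * s\<^sub>\<mu>\<close>, because it occurs in \<open>s\<^sub>\<nu>\<close> and there is no cancellation. There are only
  finitely many partitions of \<open>n\<close>, so even an infinite combination \<open>\<gamma> = \<Sum>\<^sub>i t\<^sub>i \<alpha>\<^sup>i\<close> lies in the
  convex hull of the exponents (\<open>has_sum_in_convex_hull\<close>). Since \<open>\<gamma>\<close> is integral, saturation makes
  \<open>x\<^sup>\<gamma>\<close> itself occur in \<open>s\<^sub>\<lambda> * s\<^sub>\<mu>\<close>, and hence in some \<open>s\<^sub>\<theta>\<close> with \<open>g(\<lambda>,\<mu>,\<theta>) > 0\<close>.

  A semistandard tableau of shape \<open>\<theta>\<close> and content \<open>\<gamma>\<close> shows that \<open>\<theta>\<close> dominates \<open>\<gamma>\<close>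
  (\<open>dominates_if_schur_pos\<close>). This is already the required \<open>\<theta>\<close>: all the \<open>\<alpha>\<^sup>i\<close> are weakly decreasing,
  so \<open>\<gamma>\<close> is too, and sorting does not change it (\<open>sort_desc_antimono\<close>).
\<close>

section \<open>Weakly decreasing vectors\<close>

lemma keys_eq_lessThan_if_antimono:
  fixes \<gamma> :: "nat \<Rightarrow>\<^sub>0 'a::{zero,linorder}"
  assumes anti: "antimono (lookup \<gamma>)"
  shows "\<exists>m. keys \<gamma> = {..<m}"
proof -
  obtain N where N: "\<And>j. j \<in> keys \<gamma> \<Longrightarrow> j < N"
    using finite_nat_set_iff_bounded[of "keys \<gamma>"] by auto
  \<comment> \<open>All entries lie above the zeros at the end, so nothing but zeros can follow a zero.\<close>
  have nonneg: "0 \<le> lookup \<gamma> j" for j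
  proof -
    have "lookup \<gamma> (max j N) = 0"
      using N[of "max j N"] by (auto simp: in_keys_iff)
    then show ?thesis
      using antimonoD[OF anti, of j "max j N"] by simp
  qed
  have down: "i \<in> keys \<gamma>" if "j \<in> keys \<gamma>" "i \<le> j" for i j
    using antimonoD[OF anti that(2)] nonneg[of j] that(1) by (auto simp: in_keys_iff)
  define m where "m = (LEAST m. m \<notin> keys \<gamma>)"
  have "N \<notin> keys \<gamma>"
    using N[of N] by auto
  then have m: "m \<notin> keys \<gamma>"
    unfolding m_def by (rule LeastI)
  have "i \<in> keys \<gamma> \<longleftrightarrow> i < m" for i
  proof
    show "i < m" if "i \<in> keys \<gamma>"
      using down[OF that, of m] m by (meson not_less)
    show "i \<in> keys \<gamma>" if "i < m"
      using not_less_Least[of i "\<lambda>m. m \<notin> keys \<gamma>"] that unfolding m_def by blast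
  qed
  then have "keys \<gamma> = {..<m}"
    by auto
  then show ?thesis ..
qed

lemma sort_desc_antimono:
  fixes \<gamma> :: "nat \<Rightarrow>\<^sub>0 'a::{zero,linorder}"
  assumes anti: "antimono (lookup \<gamma>)"
  shows "sort_desc \<gamma> = \<gamma>"
proof -
  obtain m where m: "keys \<gamma> = {..<m}"
    using keys_eq_lessThan_if_antimono[OF anti] by blast
  let ?xs = "map (lookup \<gamma>) [0..<m]"
  have "sorted (rev ?xs)"
    by (auto simp: sorted_rev_iff_nth_mono intro!: antimonoD[OF anti])
  then have "sort ?xs = rev ?xs"
    by (metis mset_rev properties_for_sort)
  then have "sort_desc \<gamma> = Poly_Mapping.nth ?xs"
    unfolding sort_desc_def m by (simp add: lessThan_atLeast0)
  also have "\<dots> = \<gamma>"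
    using m by (intro poly_mapping_eqI) (auto simp: nth_default_def in_keys_iff set_eq_iff)
  finally show ?thesis .
qed


section \<open>Partitions\<close>

lemma keys_partition_subset:
  assumes "p \<turnstile> n"
  shows "keys p \<subseteq> {..<n}"
proof
  fix j assume j: "j \<in> keys p"
  obtain m where m: "keys p = {..<m}"
    using assms keys_eq_lessThan_if_antimono unfolding partition_of_def by blast
  have "card (keys p) \<le> (\<Sum>i\<in>keys p. lookup p i)"
    using sum_mono[of "keys p" "\<lambda>_. 1::nat" "lookup p"] by (auto simp: in_keys_iff)
  then show "j \<in> {..<n}"
    using assms j m by (simp add: partition_of_def)
qed

lemma lookup_partition_le:
  assumes "p \<turnstile> n"
  shows "lookup p j \<le> n"
proof (cases "j \<in> keys p")
  case True
  then show ?thesis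
    using assms member_le_sum[of j "keys p" "lookup p"] by (simp add: partition_of_def)
qed (simp add: in_keys_iff)

lemma finite_partitions: "finite {p. p \<turnstile> n}"
proof (rule finite_imageD)
  show "finite (lookup ` {p. p \<turnstile> n})"
  proof (rule finite_subset)
    show "lookup ` {p. p \<turnstile> n} \<subseteq>
        {f. \<forall>i. (i \<in> {..<n} \<longrightarrow> f i \<in> {..n}) \<and> (i \<notin> {..<n} \<longrightarrow> f i = 0)}"
      using keys_partition_subset lookup_partition_le by (force simp: in_keys_iff)
  qed (intro finite_set_of_finite_funs; simp)
  show "inj_on lookup {p. p \<turnstile> n}"
    by (auto intro: inj_onI poly_mapping_eqI)
qed

lemma finite_cells: "finite (cells p)"
proof (rule finite_subset)
  show "cells p \<subseteq> (SIGMA i:keys p. {..<lookup p i})"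
    by (auto simp: cells_def in_keys_iff)
qed auto

lemma card_cells_rows_below: "card {c \<in> cells p. fst c < i} = (\<Sum>j<i. lookup p j)"
proof -
  have "{c \<in> cells p. fst c < i} = (SIGMA j:{..<i}. {..<lookup p j})"
    by (auto simp: cells_def)
  then show ?thesis by simp
qed


section \<open>Monomials of Schur functions\<close>

lemma finite_semistandard_tableaux_of_content:
  "finite {T \<in> semistandard_tableaux p. \<forall>v. card {c \<in> cells p. T c = v} = lookup \<alpha> v}"
proof (rule finite_subset)
  show "{T \<in> semistandard_tableaux p. \<forall>v. card {c \<in> cells p. T c = v} = lookup \<alpha> v}
      \<subseteq> (\<Pi>\<^sub>E c\<in>cells p. keys \<alpha>)"
  proof (clarify, intro PiE_I)
    fix T c
    assume content: "\<forall>v. card {c \<in> cells p. T c = v} = lookup \<alpha> v" and c: "c \<in> cells p"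
    have "finite {d \<in> cells p. T d = T c}" and "c \<in> {d \<in> cells p. T d = T c}"
      using c finite_cells[of p] by auto
    then have "card {d \<in> cells p. T d = T c} \<noteq> 0"
      by (metis card_0_eq empty_iff)
    then show "T c \<in> keys \<alpha>"
      using content by (simp add: in_keys_iff)
  qed (auto simp: semistandard_tableaux_def extensional_def)
qed (simp add: finite_cells finite_PiE)

text \<open>Filling row \<open>i\<close> with \<open>i\<close> gives a semistandard tableau whose content is its shape.\<close>

lemma schur_self_pos:
  assumes anti: "antimono (lookup p)"
  shows "schur p p > 0"
proof -
  let ?T = "restrict fst (cells p)"
  have "{c \<in> cells p. ?T c = v} = {v} \<times> {..<lookup p v}" for v
    by (auto simp: cells_def)
  then have content: "card {c \<in> cells p. ?T c = v} = lookup p v" for v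
    by (simp add: card_cartesian_product)
  have "?T (i, j) < ?T (Suc i, j)" if "(Suc i, j) \<in> cells p" for i j
    using that antimonoD[OF anti, of i "Suc i"] by (simp add: cells_def)
  moreover have "?T (i, j) \<le> ?T (i, Suc j)" if "(i, Suc j) \<in> cells p" for i j
    using that by (simp add: cells_def)
  ultimately have "?T \<in> semistandard_tableaux p"
    unfolding semistandard_tableaux_def by blast
  then have "{T \<in> semistandard_tableaux p. \<forall>v. card {c \<in> cells p. T c = v} = lookup p v} \<noteq> {}"
    using content by blast
  then show ?thesis
    using finite_semistandard_tableaux_of_content[of p p] by (simp add: schur_def card_gt_0_iff)
qed

lemma semistandard_row_le_entry:
  assumes "antimono (lookup p)" and "T \<in> semistandard_tableaux p" and "(i, j) \<in> cells p"
  shows "i \<le> T (i, j)"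
  using assms(3)
proof (induction i)
  case (Suc i)
  have "lookup p (Suc i) \<le> lookup p i"
    using assms(1) by (simp add: antimonoD)
  then have "(i, j) \<in> cells p"
    using Suc.prems by (simp add: cells_def)
  then show ?case
    using Suc assms(2) by (fastforce simp: semistandard_tableaux_def)
qed simp

text \<open>
  In a semistandard tableau the entries smaller than \<open>i\<close> all lie in the rows above row \<open>i\<close>, since
  columns increase strictly. Counting the cells on both sides, for every \<open>i\<close>, gives dominance.
\<close>

lemma dominates_if_schur_pos:
  assumes anti: "antimono (lookup p)" and pos: "schur p \<beta> > 0"
  shows "dominates p \<beta>"
  unfolding dominates_def
proof
  fix i
  have "{T \<in> semistandard_tableaux p. \<forall>v. card {c \<in> cells p. T c = v} = lookup \<beta> v} \<noteq> {}"
    using pos unfolding schur_def by (metis card.empty of_nat_0 less_irrefl)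
  then obtain T where T: "T \<in> semistandard_tableaux p"
    and content: "\<And>v. card {c \<in> cells p. T c = v} = lookup \<beta> v"
    by auto
  have "(\<Sum>v<i. lookup \<beta> v) = card (\<Union>v<i. {c \<in> cells p. T c = v})"
    using content finite_cells[of p] by (subst card_UN_disjoint) auto
  also have "\<dots> \<le> card {c \<in> cells p. fst c < i}"
    using semistandard_row_le_entry[OF anti T] finite_cells[of p]
    by (intro card_mono) (fastforce intro: le_less_trans)+
  also have "\<dots> = (\<Sum>j<i. lookup p j)"
    by (rule card_cells_rows_below)
  finally show "(\<Sum>j<i. lookup \<beta> j) \<le> (\<Sum>j<i. lookup p j)" .
qed


section \<open>Monomials of Kronecker products\<close>

text \<open>All terms of the Schur expansion have nonnegative coefficients, so nothing cancels.\<close>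

lemma kronecker_product_pos_iff:
  "kronecker_product n lam mu \<beta> > 0 \<longleftrightarrow>
    (\<exists>nu. nu \<turnstile> n \<and> kronecker n lam mu nu > 0 \<and> schur nu \<beta> > 0)"
proof -
  have nonneg: "0 \<le> int (kronecker n lam mu nu) * schur nu \<beta>" for nu
    by (simp add: schur_def)
  have "kronecker_product n lam mu \<beta> > 0 \<longleftrightarrow>
      (\<exists>nu\<in>{nu. nu \<turnstile> n}. int (kronecker n lam mu nu) * schur nu \<beta> \<noteq> 0)"
    unfolding kronecker_product_def
    using sum_nonneg_eq_0_iff[OF finite_partitions, of n "\<lambda>nu. int (kronecker n lam mu nu) * schur nu \<beta>"]
      sum_nonneg[of "{nu. nu \<turnstile> n}" "\<lambda>nu. int (kronecker n lam mu nu) * schur nu \<beta>"] nonneg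
    by (metis (no_types, lifting) less_le)
  also have "\<dots> \<longleftrightarrow> (\<exists>nu. nu \<turnstile> n \<and> kronecker n lam mu nu > 0 \<and> schur nu \<beta> > 0)"
    by (auto simp: schur_def)
  finally show ?thesis .
qed


section \<open>Convex combinations\<close>

lemma has_sum_fibres:
  fixes g :: "'i \<Rightarrow> 'b::topological_comm_monoid_add"
  assumes "finite F" and "\<And>p. p \<in> F \<Longrightarrow> (g has_sum s p) {i \<in> I. f i = p}"
  shows "(g has_sum (\<Sum>p\<in>F. s p)) {i \<in> I. f i \<in> F}"
  using assms
proof (induction F rule: finite_induct)
  case (insert q F)
  have "{i \<in> I. f i \<in> insert q F} = {i \<in> I. f i = q} \<union> {i \<in> I. f i \<in> F}"
    by auto
  moreover have "{i \<in> I. f i = q} \<inter> {i \<in> I. f i \<in> F} = {}"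
    using insert.hyps by auto
  ultimately show ?case
    using insert by (auto intro!: has_sum_Un_disjoint)
qed simp

text \<open>Collecting the weights of equal points turns the infinite combination into a finite one.\<close>

lemma has_sum_in_convex_hull:
  fixes f :: "'i \<Rightarrow> 'v::real_normed_vector"
  assumes fin: "finite F" and f: "\<And>i. i \<in> I \<Longrightarrow> f i \<in> F"
    and nonneg: "\<And>i. i \<in> I \<Longrightarrow> 0 \<le> t i"
    and t: "(t has_sum 1) I" and x: "((\<lambda>i. t i *\<^sub>R f i) has_sum x) I"
  shows "x \<in> convex hull F"
proof -
  let ?w = "\<lambda>p. infsum t {i \<in> I. f i = p}"
  have I: "{i \<in> I. f i \<in> F} = I"
    using f by auto
  have w: "(t has_sum ?w p) {i \<in> I. f i = p}" for p
    using summable_on_subset_banach[OF has_sum_imp_summable[OF t], of "{i \<in> I. f i = p}"] by auto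
  have wf: "((\<lambda>i. t i *\<^sub>R f i) has_sum ?w p *\<^sub>R p) {i \<in> I. f i = p}" for p
    using has_sum_bounded_linear[OF bounded_linear_scaleR_left w]
    by (rule has_sum_cong[THEN iffD1, rotated]) auto
  have "x = (\<Sum>p\<in>F. ?w p *\<^sub>R p)"
    using has_sum_unique[OF x] has_sum_fibres[OF fin wf] unfolding I by blast
  moreover have "(\<Sum>p\<in>F. ?w p) = 1"
    using has_sum_unique[OF t] has_sum_fibres[OF fin w] unfolding I by fastforce
  moreover have "0 \<le> ?w p" for p
    using nonneg by (intro infsum_nonneg) auto
  ultimately show ?thesis
    unfolding convex_hull_finite[OF fin] by (intro CollectI exI[of _ ?w]) simp
qed

lemma lookup_scaleR: "lookup (r *\<^sub>R x) i = r *\<^sub>R lookup x i"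
  by (simp add: scaleR_poly_mapping_def)

lemma lookup_real_vec: "lookup (real_vec p) i = real (lookup p i)"
  by (simp add: Poly_Mapping.map.rep_eq when_def)

lemma convex_antimono_vectors: "convex {x :: nat \<Rightarrow>\<^sub>0 real. antimono (lookup x)}"
  by (auto simp: convex_def antimono_def lookup_add lookup_scaleR intro!: add_mono mult_left_mono)

lemma convex_vectors_supported_in: "convex {x :: nat \<Rightarrow>\<^sub>0 real. keys x \<subseteq> K}"
proof -
  have "{x :: nat \<Rightarrow>\<^sub>0 real. keys x \<subseteq> K} = {x. \<forall>i. i \<notin> K \<longrightarrow> lookup x i = 0}"
    by (auto simp: in_keys_iff)
  then show ?thesis
    by (simp add: convex_def lookup_add lookup_scaleR)
qed


section \<open>Integral convex combinations of partitions\<close>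

theorem proposition1p8:
  fixes n :: nat and lam mu :: "nat \<Rightarrow>\<^sub>0 nat"
    and I :: "nat set" and \<alpha> :: "nat \<Rightarrow> (nat \<Rightarrow>\<^sub>0 nat)" and t :: "nat \<Rightarrow> real"
    and \<gamma> :: "nat \<Rightarrow>\<^sub>0 real"
  assumes "lam \<turnstile> n" and "mu \<turnstile> n"
    and "saturated_newton_polytope (kronecker_product n lam mu)"
    and "\<And>i. i \<in> I \<Longrightarrow> \<alpha> i \<turnstile> n"
    and "\<And>i. i \<in> I \<Longrightarrow> kronecker n lam mu (\<alpha> i) > 0"
    and "\<And>i. i \<in> I \<Longrightarrow> 0 \<le> t i \<and> t i \<le> 1"
    and "(t has_sum 1) I"
    and "((\<lambda>i. t i *\<^sub>R real_vec (\<alpha> i)) has_sum \<gamma>) I"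
    and "\<And>j. lookup \<gamma> j \<in> \<int>"
  shows "\<exists>\<theta>. \<theta> \<turnstile> n \<and> dominates (real_vec \<theta>) (sort_desc \<gamma>) \<and> kronecker n lam mu \<theta> > 0"
proof -
  let ?f = "kronecker_product n lam mu"
  \<comment> \<open>All partitions of \<open>n\<close> fit into \<open>n\<close> variables; one more makes the number positive for \<open>n = 0\<close>.\<close>
  let ?k = "Suc n"
  define P where "P = {p. p \<turnstile> n \<and> kronecker n lam mu p > 0}"
  have "finite (real_vec ` P)"
    using finite_partitions[of n] by (auto simp: P_def)
  then have hull: "\<gamma> \<in> convex hull (real_vec ` P)"
    using assms(4-8) by (intro has_sum_in_convex_hull[where t = t and I = I]) (auto simp: P_def)
  have keys: "keys p \<subseteq> {..<?k}" if "p \<turnstile> n" for p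
    using keys_partition_subset[OF that] by auto
  have "real_vec ` P \<subseteq> {x. keys x \<subseteq> {..<?k}}"
    using keys by (auto simp: P_def in_keys_iff lookup_real_vec subset_iff)
  then have "keys \<gamma> \<subseteq> {..<?k}"
    using hull_minimal[where S = convex, OF _ convex_vectors_supported_in] hull by blast
  then have integral: "\<gamma> \<in> integer_points ?k"
    using assms(9) by (simp add: integer_points_def)
  have "real_vec ` P \<subseteq> {x. antimono (lookup x)}"
    by (auto simp: P_def partition_of_def antimono_def lookup_real_vec)
  then have anti: "antimono (lookup \<gamma>)"
    using hull_minimal[where S = convex, OF _ convex_antimono_vectors] hull by blast

  have "real_vec p \<in> exponents ?k (specialize ?k ?f)" if "p \<in> P" for p
  proof -
    have p: "p \<turnstile> n" "kronecker n lam mu p > 0"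
      using that by (auto simp: P_def)
    then have "?f p > 0"
      using schur_self_pos[of p] by (auto simp: kronecker_product_pos_iff partition_of_def)
    then show ?thesis
      using keys[OF p(1)] by (auto simp: exponents_def specialize_def)
  qed
  then have "real_vec ` P \<subseteq> exponents ?k (specialize ?k ?f)"
    by blast
  then have "\<gamma> \<in> convex hull (exponents ?k (specialize ?k ?f))"
    using hull hull_mono by blast
  moreover have "saturated_newton_polytope_poly ?k (specialize ?k ?f)"
    using assms(3) by (simp add: saturated_newton_polytope_def)
  ultimately have "\<gamma> \<in> exponents ?k (specialize ?k ?f)"
    using integral unfolding saturated_newton_polytope_poly_def by blast
  then obtain \<beta> where \<beta>: "\<gamma> = real_vec \<beta>" "?f \<beta> > 0"
    by (auto simp: exponents_def specialize_def split: if_splits)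
  then obtain \<theta> where \<theta>: "\<theta> \<turnstile> n" "kronecker n lam mu \<theta> > 0" "schur \<theta> \<beta> > 0"
    by (auto simp: kronecker_product_pos_iff)
  have "dominates \<theta> \<beta>"
    using \<theta> by (intro dominates_if_schur_pos) (auto simp: partition_of_def)
  then have "dominates (real_vec \<theta>) \<gamma>"
    unfolding dominates_def \<beta>(1) lookup_real_vec by (simp flip: of_nat_sum)
  then show ?thesis
    using \<theta> sort_desc_antimono[OF anti] by auto
qed

end
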